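(* The pots $$P_1=\big\{\{1,1,1\},\{2,2,2\},\{-2,-3,-3\},\{-1,-4,-4\},\{-1,3,-5\},\{-2,4,5\}\big\}$$ and $$P_2=\big\{\{1,1,1\},\{2,2,2\},\{-2,-3,-3\},\{-1,-4,-4\},\{3,4,5\},\{-1,-2,-5\}\big\}$$ (inner braces denoting multisets) are non-isomorphic pots.
   Context: A tile is a finite multiset of integers; a pot is a set of tiles. $\Sigma(P)$ is the set of positive integers (colors) appearing in some tile of the pot $P$. Two pots $P,P'$ are isomorphic if there is a bijection $f:\pm\Sigma(P)\to\pm\Sigma(P')$, where $\pm X=X\cup(-X)$, with $f(-i)=-f(i)$ for all $i$ and $f(P)=P'$, where $f$ is applied elementwise (with multiplicity) to tiles and to each tile of a pot. *)

theory Defs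
  imports "HOL-Library.Multiset"
begin

type_synonym tile = "int multiset"
type_synonym pot = "tile set"

definition colors :: "pot \<Rightarrow> int set" where
  "colors P = {i. i > 0 \<and> (\<exists>t\<in>P. i \<in># t)}"

definition pm :: "int set \<Rightarrow> int set" where
  "pm X = X \<union> uminus ` X"

(* A map on pm (colors P) is modelled by a total function on the integers, of which
   only the values on pm (colors P) matter as long as every entry of every tile of P
   lies in pm (colors P). *)
definition pot_isomorphic :: "pot \<Rightarrow> pot \<Rightarrow> bool" where
  "pot_isomorphic P P' \<longleftrightarrow>
     (\<exists>f :: int \<Rightarrow> int.
        bij_betw f (pm (colors P)) (pm (colors P')) \<and>
        (\<forall>i\<in>pm (colors P). f (- i) = - f i) \<and>
        image_mset f ` P = P')"

definition pot1 :: pot where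
  "pot1 = {{#1, 1, 1#}, {#2, 2, 2#}, {#-2, -3, -3#}, {#-1, -4, -4#}, {#-1, 3, -5#}, {#-2, 4, 5#}}"

definition pot2 :: pot where
  "pot2 = {{#1, 1, 1#}, {#2, 2, 2#}, {#-2, -3, -3#}, {#-1, -4, -4#}, {#3, 4, 5#}, {#-1, -2, -5#}}"

end

theory Submission
  imports Defs
begin

text \<open>The tiles \<open>{1,1,1}\<close> and \<open>{2,2,2}\<close> force an isomorphism to permute the colors 1 and 2.
  The tile \<open>{-2,-3,-3}\<close> then determines the image of 3, so that the image of
  \<open>{-1,3,-5}\<close> contains \<open>{-1,3}\<close> or \<open>{-2,4}\<close>; no tile of the second pot does.\<close>

lemma colors_pot1: "colors pot1 = {1, 2, 3, 4, 5}"
  unfolding colors_def pot1_def by auto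

text \<open>Supports suffice to tell the relevant tiles apart, and equations between explicit finite
  sets are easier to decide than those between multisets.\<close>

lemma set_mset_pot2:
  assumes "t \<in> pot2"
  shows "set_mset t \<in> {{1}, {2}, {-2, -3}, {-1, -4}, {3, 4, 5}, {-1, -2, -5}}"
  using assms unfolding pot2_def by (elim insertE emptyE; simp)

lemma cube_in_pot2: "{#a, a, a#} \<in> pot2 \<Longrightarrow> a = 1 \<or> a = 2"
  by (drule set_mset_pot2) (auto simp: set_eq_subset)

text \<open>The support has at most two elements, and among such supports only one contains -1 and
  only one contains -2.\<close>

lemma double_in_pot2:
  "{#-1, b, b#} \<in> pot2 \<Longrightarrow> b = -4"
  "{#-2, b, b#} \<in> pot2 \<Longrightarrow> b = -3"
  by (drule set_mset_pot2, auto simp: set_eq_subset)+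

text \<open>The entry \<open>y\<close> is arbitrary, so the value \<open>f (-5)\<close> never has to
  be determined.\<close>

lemma not_in_pot2:
  "{#-1, 3, y#} \<notin> pot2"
  "{#-2, 4, y#} \<notin> pot2"
  by (auto dest!: set_mset_pot2 simp: set_eq_subset)

theorem mainTheorem4: "\<not> pot_isomorphic pot1 pot2"
proof
  assume "pot_isomorphic pot1 pot2"
  then obtain f where bij: "bij_betw f (pm (colors pot1)) (pm (colors pot2))"
    and odd: "\<forall>i\<in>pm (colors pot1). f (- i) = - f i"
    and img: "image_mset f ` pot1 = pot2"
    unfolding pot_isomorphic_def by blast
  have neg: "f (-1) = - f 1" "f (-2) = - f 2" "f (-3) = - f 3"
    by (rule odd[rule_format], simp add: colors_pot1 pm_def)+
  have "f 1 \<noteq> f 2"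
    using inj_onD[OF bij_betw_imp_inj_on[OF bij], of 1 2] by (auto simp: colors_pot1 pm_def)
  have tiles: "image_mset f t \<in> pot2" if "t \<in> pot1" for t
    using img that by blast
  have "{#f 1, f 1, f 1#} \<in> pot2" "{#f 2, f 2, f 2#} \<in> pot2"
    and t3: "{#- f 2, - f 3, - f 3#} \<in> pot2"
    and t5: "{#- f 1, f 3, f (-5)#} \<in> pot2"
    using tiles[of "{#1, 1, 1#}"] tiles[of "{#2, 2, 2#}"] tiles[of "{#-2, -3, -3#}"]
      tiles[of "{#-1, 3, -5#}"]
    by (simp_all add: pot1_def neg)
  with \<open>f 1 \<noteq> f 2\<close> consider "f 1 = 1" "f 2 = 2" | "f 1 = 2" "f 2 = 1"
    using cube_in_pot2 by metis
  then show False
  proof cases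
    case 1
    then have "f 3 = 3" using t3 double_in_pot2(2)[of "- f 3"] by simp
    then show False using 1 t5 not_in_pot2(1) by simp
  next
    case 2
    then have "f 3 = 4" using t3 double_in_pot2(1)[of "- f 3"] by simp
    then show False using 2 t5 not_in_pot2(2) by simp
  qed
qed

end
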